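(* Let $G$ be a Polish group, let $X$ be a Polish space with a continuous action $G\curvearrowright X$, and suppose that the orbit equivalence relation $E^X_G$ is essentially countable. Then $E^X_G$ is $\sigma$-lacunary.
   Context: For a continuous action of a Polish group $G$ on a Polish space $X$, the orbit equivalence relation is $E^X_G=\{(x,y)\in X\times X:\exists g\in G\ g\cdot x=y\}$. For equivalence relations $E$ on $X$ and $F$ on $Y$ (Polish or standard Borel spaces), $E\le_B F$ means there is a Borel map $\psi:X\to Y$ with $(x,y)\in E\iff(\psi(x),\psi(y))\in F$ for all $x,y\in X$; $E\sim_B F$ means $E\le_B F$ and $F\le_B E$. An equivalence relation $F$ is countable if every $F$-class is countable. $E$ is essentially countable if $E\sim_B F$ for some countable Borel equivalence relation $F$ on a Polish space. $E^X_G$ is $\sigma$-lacunary if there are Borel sets $B_n\subseteq X$ and open neighbourhoods $V_n\subseteq G$ of $1_G$ ($n<\omega$) such that $\bigcup_n B_n$ is a countable complete section of $E^X_G$ (i.e. it meets every orbit, and meets each orbit in at most countably many points) and each $B_n$ is $V_n$-lacunary: whenever $g\cdot x=y$ with $g\in V_n$ and $x,y\in B_n$, then $x=y$. *)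

theory Defs
  imports "HOL-Analysis.Analysis"
begin

text \<open>Polish groups: a type carrying a (not necessarily abelian) group structure,
  written additively via group_add, and a Polish topology (class polish_space),
  such that multiplication and inversion are continuous.\<close>
definition polish_group :: "('g::{polish_space, group_add}) itself \<Rightarrow> bool" where
  "polish_group _ \<longleftrightarrow>
     continuous_on UNIV (\<lambda>p::'g \<times> 'g. fst p + snd p) \<and>
     continuous_on UNIV (\<lambda>g::'g. - g)"

definition continuous_action :: "('g::{topological_space, group_add} \<Rightarrow> 'x::topological_space \<Rightarrow> 'x) \<Rightarrow> bool" where
  "continuous_action act \<longleftrightarrow>
     continuous_on UNIV (\<lambda>p::'g \<times> 'x. act (fst p) (snd p)) \<and>
     (\<forall>x. act 0 x = x) \<and>
     (\<forall>g h x. act (g + h) x = act g (act h x))"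

definition orbit_eqrel :: "('g \<Rightarrow> 'x \<Rightarrow> 'x) \<Rightarrow> ('x \<times> 'x) set" where
  "orbit_eqrel act = {(x, y). \<exists>g. act g x = y}"

definition borel_reducible ::
  "('x::topological_space \<times> 'x) set \<Rightarrow> ('y::topological_space \<times> 'y) set \<Rightarrow> bool" where
  "borel_reducible E F \<longleftrightarrow>
     (\<exists>\<psi> \<in> borel_measurable (borel :: 'x measure).
        \<forall>x y. (x, y) \<in> E \<longleftrightarrow> (\<psi> x, \<psi> y) \<in> F)"

definition borel_bireducible ::
  "('x::topological_space \<times> 'x) set \<Rightarrow> ('y::topological_space \<times> 'y) set \<Rightarrow> bool" where
  "borel_bireducible E F \<longleftrightarrow> borel_reducible E F \<and> borel_reducible F E"

definition countable_borel_eqrel :: "('y::topological_space \<times> 'y) set \<Rightarrow> bool" where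
  "countable_borel_eqrel F \<longleftrightarrow>
     equiv UNIV F \<and> F \<in> sets (borel :: ('y \<times> 'y) measure) \<and> (\<forall>y. countable (F `` {y}))"

definition countable_complete_section :: "('x \<times> 'x) set \<Rightarrow> 'x set \<Rightarrow> bool" where
  "countable_complete_section E B \<longleftrightarrow>
     (\<forall>x. \<exists>y \<in> B. (x, y) \<in> E) \<and> (\<forall>x. countable (B \<inter> E `` {x}))"

definition lacunary :: "('g \<Rightarrow> 'x \<Rightarrow> 'x) \<Rightarrow> 'g set \<Rightarrow> 'x set \<Rightarrow> bool" where
  "lacunary act V B \<longleftrightarrow>
     (\<forall>g \<in> V. \<forall>x \<in> B. \<forall>y \<in> B. act g x = y \<longrightarrow> x = y)"

definition sigma_lacunary ::
  "('g::{topological_space, group_add} \<Rightarrow> 'x::topological_space \<Rightarrow> 'x) \<Rightarrow> bool" where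
  "sigma_lacunary act \<longleftrightarrow>
     (\<exists>B :: nat \<Rightarrow> 'x set. \<exists>V :: nat \<Rightarrow> 'g set.
        (\<forall>n. B n \<in> sets (borel :: 'x measure)) \<and>
        (\<forall>n. open (V n) \<and> 0 \<in> V n) \<and>
        countable_complete_section (orbit_eqrel act) (\<Union>n. B n) \<and>
        (\<forall>n. lacunary act (V n) (B n)))"

end

theory Submission
  imports Defs
begin

text \<open>Let \<open>\<psi>\<close> reduce the orbit equivalence relation to a countable \<open>F\<close>. Every orbit is a countable union
  of fibres of \<open>\<psi>\<close>, so by Baire category it contains \<open>x\<close> such that \<open>\<psi> (g x) = \<psi> x\<close> for nonmeagerly
  many \<open>g\<close>. Largeness in this sense is a Borel condition that depends only on \<open>\<psi> x\<close>, so a large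
  section uniformization yields a Borel set \<open>C\<close> on which \<open>\<psi>\<close> is injective and which meets every
  orbit, in a countable set because \<open>F\<close> is countable. Each \<open>z \<in> C\<close> satisfies \<open>\<psi> (g z) = \<psi> z\<close> for comeagerly
  many \<open>g\<close> in some basic open set \<open>W n\<close>. If \<open>z\<close>, \<open>z'\<close> do so for the same \<open>W n \<ni> q n\<close> and
  \<open>z' = k z\<close> with \<open>q n + k \<in> W n\<close>, then \<open>W n\<close> and \<open>W n + k\<close> overlap, which forces \<open>\<psi> z = \<psi> z'\<close> and
  hence \<open>z = z'\<close>. Thus the translates by \<open>q n\<close> of the corresponding pieces of \<open>C\<close> are lacunary.\<close>

section \<open>Meager sets and the Baire property\<close>

text \<open>First category, coded by a countable cover with closed nowhere dense sets, the form that
  \<open>Baire_category_alt\<close> consumes.\<close>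

definition meager :: "'a::topological_space set \<Rightarrow> bool" where
  "meager S \<longleftrightarrow> (\<exists>\<N>. countable \<N> \<and> (\<forall>T\<in>\<N>. closed T \<and> interior T = {}) \<and> S \<subseteq> \<Union>\<N>)"

lemma meager_subset: "meager T \<Longrightarrow> S \<subseteq> T \<Longrightarrow> meager S"
  unfolding meager_def by (meson order_trans)

lemma meager_empty [simp]: "meager {}"
  unfolding meager_def by (intro exI[of _ "{}"]) simp

lemma meager_Union:
  assumes "countable I" "\<And>i. i \<in> I \<Longrightarrow> meager (S i)"
  shows "meager (\<Union>i\<in>I. S i)"
proof -
  from assms(2) have "\<forall>i\<in>I. \<exists>\<N>. countable \<N> \<and> (\<forall>T\<in>\<N>. closed T \<and> interior T = {}) \<and> S i \<subseteq> \<Union>\<N>"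
    unfolding meager_def by blast
  then obtain \<N> where \<N>: "\<forall>i\<in>I. countable (\<N> i) \<and> (\<forall>T\<in>\<N> i. closed T \<and> interior T = {}) \<and> S i \<subseteq> \<Union>(\<N> i)"
    by metis
  have "countable (\<Union>i\<in>I. \<N> i)"
    using assms(1) \<N> by simp
  moreover have "closed T \<and> interior T = {}" if "T \<in> (\<Union>i\<in>I. \<N> i)" for T
    using \<N> that by blast
  moreover have "S i \<subseteq> \<Union>(\<Union>i\<in>I. \<N> i)" if "i \<in> I" for i
  proof -
    have "S i \<subseteq> \<Union>(\<N> i)" using \<N> that by blast
    also have "\<dots> \<subseteq> \<Union>(\<Union>i\<in>I. \<N> i)" using that by blast
    finally show ?thesis .
  qed
  ultimately show ?thesis
    unfolding meager_def by (meson UN_least)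
qed

lemma meager_Un: "meager S \<Longrightarrow> meager T \<Longrightarrow> meager (S \<union> T)"
  using meager_Union[of "{S, T}" "\<lambda>A. A"] by auto

lemma meager_closed: "closed S \<Longrightarrow> interior S = {} \<Longrightarrow> meager S"
  unfolding meager_def by (intro exI[of _ "{S}"]) auto

lemma not_meager_open:
  fixes U :: "'a::complete_space set"
  assumes "open U" "U \<noteq> {}"
  shows "\<not> meager U"
proof
  assume "meager U"
  then obtain \<N> where \<N>: "countable \<N>" "\<forall>T\<in>\<N>. closed T \<and> interior T = {}" "U \<subseteq> \<Union>\<N>"
    unfolding meager_def by blast
  have "euclidean interior_of \<Union>\<N> = {}"
    using \<N> by (intro Baire_category_alt) (auto simp: completely_metrizable_space_euclidean)
  then show False
    using interior_maximal[OF \<N>(3) assms(1)] assms(2) by simp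
qed

text \<open>Needed for right translations of the group. The image under \<open>f\<close> of an open
  subset of the preimage of \<open>T\<close> is open, being a preimage under \<open>f'\<close>, and
  lies in \<open>T\<close>; so it is empty when \<open>T\<close> is nowhere dense.\<close>

lemma meager_vimage_homeomorphism:
  assumes "continuous_on UNIV f" "continuous_on UNIV f'" "\<And>x. f (f' x) = x" "\<And>x. f' (f x) = x"
    and "meager S"
  shows "meager (f -` S)"
proof -
  obtain \<N> where \<N>: "countable \<N>" "\<forall>T\<in>\<N>. closed T \<and> interior T = {}" "S \<subseteq> \<Union>\<N>"
    using assms(5) unfolding meager_def by blast
  have "closed (f -` T) \<and> interior (f -` T) = {}" if "T \<in> \<N>" for T
  proof
    show "closed (f -` T)"
      using \<N>(2) that assms(1) by (blast intro: closed_vimage)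
    have "open (f' -` interior (f -` T))"
      using assms(2) by (simp add: open_vimage)
    moreover have "f' -` interior (f -` T) \<subseteq> T"
    proof
      fix x assume "x \<in> f' -` interior (f -` T)"
      then have "f' x \<in> f -` T" using interior_subset by blast
      then show "x \<in> T" using assms(3) by simp
    qed
    ultimately have "f' -` interior (f -` T) \<subseteq> interior T"
      by (rule interior_maximal[rotated])
    then have "f' -` interior (f -` T) = {}"
      using \<N>(2) that by simp
    moreover have "f x \<in> f' -` interior (f -` T)" if "x \<in> interior (f -` T)" for x
      using that assms(4) by simp
    ultimately show "interior (f -` T) = {}"
      by blast
  qed
  moreover have "f -` S \<subseteq> \<Union>((\<lambda>T. f -` T) ` \<N>)"
    using \<N>(3) by blast
  ultimately show ?thesis
    unfolding meager_def using \<N>(1) by (intro exI[of _ "(\<lambda>T. f -` T) ` \<N>"]) simp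
qed

text \<open>This variant of the Baire property avoids symmetric differences and is all that is
  needed to pull a complement out of a category quantifier.\<close>

definition baire_property :: "'a::topological_space set \<Rightarrow> bool" where
  "baire_property S \<longleftrightarrow>
     (\<forall>U. open U \<longrightarrow> \<not> meager (U \<inter> S) \<longrightarrow> (\<exists>V. open V \<and> V \<noteq> {} \<and> V \<subseteq> U \<and> meager (V - S)))"

lemma baire_property_open: "open S \<Longrightarrow> baire_property S"
  unfolding baire_property_def
proof (intro allI impI)
  fix U assume "open S" "open U" "\<not> meager (U \<inter> S)"
  then show "\<exists>V. open V \<and> V \<noteq> {} \<and> V \<subseteq> U \<and> meager (V - S)"
    by (intro exI[of _ "U \<inter> S"]) (auto simp: Diff_eq)
qed

lemma baire_property_UN:
  fixes S :: "nat \<Rightarrow> 'a::topological_space set"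
  assumes "\<And>i. baire_property (S i)"
  shows "baire_property (\<Union>i. S i)"
  unfolding baire_property_def
proof (intro allI impI)
  fix U :: "'a set" assume U: "open U" "\<not> meager (U \<inter> (\<Union>i. S i))"
  moreover have "U \<inter> (\<Union>i. S i) = (\<Union>i. U \<inter> S i)"
    by blast
  ultimately obtain i where "\<not> meager (U \<inter> S i)"
    using meager_Union[of UNIV "\<lambda>i. U \<inter> S i"] by (metis countableI_type)
  then obtain V where "open V" "V \<noteq> {}" "V \<subseteq> U" "meager (V - S i)"
    using assms[of i] U(1) unfolding baire_property_def by blast
  then show "\<exists>V. open V \<and> V \<noteq> {} \<and> V \<subseteq> U \<and> meager (V - (\<Union>i. S i))"
    by (intro exI[of _ V]) (auto intro: meager_subset)
qed

text \<open>Lindelof cuts an arbitrary union of open sets down to a countable one. Hence there is a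
  largest open set in which \<open>S\<close> is comeager.\<close>

lemma meager_Union_open:
  fixes \<V> :: "'a::second_countable_topology set set"
  assumes "\<And>V. V \<in> \<V> \<Longrightarrow> open V \<and> meager (V - S)"
  shows "meager (\<Union>\<V> - S)"
proof -
  obtain \<V>' where "\<V>' \<subseteq> \<V>" "countable \<V>'" "\<Union>\<V>' = \<Union>\<V>"
    using Lindelof[of \<V>] assms by blast
  then show ?thesis
    using meager_Union[of \<V>' "\<lambda>V. V - S"] assms by (auto simp: UN_extend_simps subset_iff)
qed

text \<open>If \<open>S\<close> is nonmeager in every nonempty open subset of \<open>U\<close>, then
  the open sets in which \<open>S\<close> is comeager have dense union in \<open>U\<close>, and
  \<open>U - S\<close> is meager.\<close>

lemma baire_property_Compl:
  fixes S :: "'a::second_countable_topology set"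
  assumes "baire_property S"
  shows "baire_property (- S)"
  unfolding baire_property_def
proof (intro allI impI)
  fix U :: "'a set" assume U: "open U" "\<not> meager (U \<inter> - S)"
  show "\<exists>V. open V \<and> V \<noteq> {} \<and> V \<subseteq> U \<and> meager (V - - S)"
  proof (rule ccontr)
    assume *: "\<not> ?thesis"
    define W where "W = \<Union>{V. open V \<and> V \<subseteq> U \<and> meager (V - S)}"
    have "open W"
      unfolding W_def by auto
    have "meager (W - S)"
      unfolding W_def by (rule meager_Union_open) auto
    \<comment> \<open>The closure makes this difference closed, so that empty interior already gives
      meagerness; it still contains \<open>U - W\<close>.\<close>
    have "interior (closure U - W) = {}"
    proof (rule ccontr)
      assume "interior (closure U - W) \<noteq> {}"
      then have "interior (closure U - W) \<inter> U \<noteq> {}"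
        using interior_subset[of "closure U - W"]
        by (metis Diff_subset inf_commute open_Int_closure_eq_empty open_interior inf.absorb_iff1 order_trans)
      moreover define V where "V = interior (closure U - W) \<inter> U"
      ultimately have V: "open V" "V \<noteq> {}" "V \<subseteq> U" "V \<inter> W = {}"
        using U interior_subset[of "closure U - W"] by auto
      with * have "\<not> meager (V \<inter> S)"
        by (auto simp: Diff_eq)
      then obtain V' where V': "open V'" "V' \<noteq> {}" "V' \<subseteq> V" "meager (V' - S)"
        using assms V(1) unfolding baire_property_def by blast
      then have "V' \<subseteq> W"
        using V unfolding W_def by blast
      with V V' show False by blast
    qed
    then have "meager (closure U - W)"
      using \<open>open W\<close> by (intro meager_closed) auto
    then have "meager ((W - S) \<union> (closure U - W))"
      using \<open>meager (W - S)\<close> by (intro meager_Un)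
    then have "meager (U \<inter> - S)"
      by (rule meager_subset) (use closure_subset[of U] in auto)
    with U show False by blast
  qed
qed

section \<open>Category properties of Borel sets\<close>

lemma borel_induct [consumes 1, case_names base compl union]:
  assumes "S \<in> sets borel"
    and "\<And>U. open U \<Longrightarrow> P U"
    and "\<And>A. A \<in> sets borel \<Longrightarrow> P A \<Longrightarrow> P (- A)"
    and "\<And>A. (\<And>i::nat. A i \<in> sets borel) \<Longrightarrow> (\<And>i. P (A i)) \<Longrightarrow> P (\<Union>i. A i)"
  shows "P S"
proof -
  have "S \<in> sigma_sets UNIV (Collect open)"
    using assms(1) by (simp add: sets_borel)
  then show ?thesis
  proof induction
    case Empty
    then show ?case using assms(2) by simp
  next
    case (Compl A)
    then show ?case using assms(3)[of A] by (simp add: sets_borel Compl_eq_Diff_UNIV)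
  next
    case (Union A)
    then show ?case using assms(4)[of A] by (simp add: sets_borel)
  qed (use assms(2) in auto)
qed

lemma baire_property_borel:
  fixes S :: "'a::second_countable_topology set"
  assumes "S \<in> sets borel"
  shows "baire_property S"
  using assms by (induction rule: borel_induct)
    (auto intro: baire_property_open baire_property_Compl baire_property_UN)

lemma borel_section:
  fixes A :: "('a::second_countable_topology \<times> 'b::second_countable_topology) set"
  assumes "A \<in> sets borel"
  shows "{g. (x, g) \<in> A} \<in> sets borel"
proof -
  have "(\<lambda>g. (x, g)) \<in> borel_measurable (borel :: 'b measure)"
    by measurable
  from measurable_sets[OF this assms] show ?thesis
    by (simp add: vimage_def)
qed

text \<open>Induction over Borel sets with \<open>U\<close> left general, because the complement
  step passes to smaller open sets: by the Baire property, the complement of a section is nonmeager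
  in \<open>U\<close> iff the section is meager in some nonempty basic open subset of
  \<open>U\<close>.\<close>

lemma Montgomery_Novikov:
  fixes A :: "('a::second_countable_topology \<times> 'b::polish_space) set"
  assumes "A \<in> sets borel" "open U"
  shows "{x. \<not> meager {g\<in>U. (x, g) \<in> A}} \<in> sets borel"
  using assms
proof (induction arbitrary: U rule: borel_induct)
  case (base W)
  have op: "open {g\<in>U. (x, g) \<in> W}" for x
  proof -
    have "open ((\<lambda>g. (x, g)) -` W)"
      using base by (intro open_vimage) (auto intro!: continuous_intros)
    then show ?thesis
      using base by (simp add: Collect_conj_eq vimage_def open_Int)
  qed
  \<comment> \<open>Open sections are nonmeager as soon as they are nonempty, so the quantifier
    reduces to the projection of an open set.\<close>
  have "{x. \<not> meager {g\<in>U. (x, g) \<in> W}} = (\<Union>g\<in>U. (\<lambda>x. (x, g)) -` W)"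
    using not_meager_open[OF op] by (auto simp: set_eq_iff) (metis (mono_tags, lifting) empty_Collect_eq meager_empty)
  moreover have "open ((\<lambda>x. (x, g)) -` W)" for g
    using base by (intro open_vimage) (auto intro!: continuous_intros)
  ultimately show ?case
    by (auto intro!: borel_open)
next
  case (compl A)
  obtain \<B> :: "'b set set" where \<B>: "countable \<B>" "topological_basis \<B>"
    using ex_countable_basis by blast
  define \<B>' where "\<B>' = {V\<in>\<B>. V \<noteq> {} \<and> V \<subseteq> U}"
  have "\<not> meager {g\<in>U. (x, g) \<in> - A} \<longleftrightarrow> (\<exists>V\<in>\<B>'. meager {g\<in>V. (x, g) \<in> A})" for x
  proof
    assume "\<not> meager {g\<in>U. (x, g) \<in> - A}"
    moreover have "{g\<in>U. (x, g) \<in> - A} = U \<inter> - {g. (x, g) \<in> A}"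
      by auto
    moreover have "baire_property (- {g. (x, g) \<in> A})"
      using borel_section[OF compl.hyps] by (intro baire_property_borel borel_comp)
    ultimately obtain W where W: "open W" "W \<noteq> {}" "W \<subseteq> U" "meager (W - - {g. (x, g) \<in> A})"
      using compl.prems unfolding baire_property_def by metis
    then obtain w where "w \<in> W" by blast
    then obtain V where "V \<in> \<B>" "w \<in> V" "V \<subseteq> W"
      using \<B>(2) W(1) topological_basisE by metis
    with W show "\<exists>V\<in>\<B>'. meager {g\<in>V. (x, g) \<in> A}"
      unfolding \<B>'_def by (intro bexI[of _ V]) (auto intro: meager_subset)
  next
    assume "\<exists>V\<in>\<B>'. meager {g\<in>V. (x, g) \<in> A}"
    then obtain V where V: "V \<in> \<B>'" "meager {g\<in>V. (x, g) \<in> A}" by blast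
    show "\<not> meager {g\<in>U. (x, g) \<in> - A}"
    proof
      assume "meager {g\<in>U. (x, g) \<in> - A}"
      then have "meager ({g\<in>V. (x, g) \<in> A} \<union> {g\<in>U. (x, g) \<in> - A})"
        using V by (intro meager_Un)
      then have "meager V"
        by (rule meager_subset) (use V in \<open>auto simp: \<B>'_def\<close>)
      moreover have "open V" "V \<noteq> {}"
        using V \<B>(2) by (auto simp: \<B>'_def topological_basis_open)
      ultimately show False using not_meager_open by blast
    qed
  qed
  then have "{x. \<not> meager {g\<in>U. (x, g) \<in> - A}} = (\<Union>V\<in>\<B>'. - {x. \<not> meager {g\<in>V. (x, g) \<in> A}})"
    by auto
  moreover have "- {x. \<not> meager {g\<in>V. (x, g) \<in> A}} \<in> sets borel" if "V \<in> \<B>'" for V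
    using compl.IH[of V] that \<B>(2) by (auto simp: \<B>'_def topological_basis_open intro: borel_comp)
  moreover have "countable \<B>'"
    using \<B>(1) unfolding \<B>'_def by (rule countable_subset[rotated]) auto
  ultimately show ?case
    by (auto intro: sets.countable_UN')
next
  case (union A)
  have "\<not> meager {g\<in>U. (x, g) \<in> (\<Union>i. A i)} \<longleftrightarrow> (\<exists>i. \<not> meager {g\<in>U. (x, g) \<in> A i})" for x
  proof -
    have "{g\<in>U. (x, g) \<in> (\<Union>i. A i)} = (\<Union>i. {g\<in>U. (x, g) \<in> A i})" by auto
    then show ?thesis
      using meager_Union[of UNIV "\<lambda>i. {g\<in>U. (x, g) \<in> A i}"]
      by (metis (no_types, lifting) UNIV_I UN_upper countableI_type meager_subset)
  qed
  then have "{x. \<not> meager {g\<in>U. (x, g) \<in> (\<Union>i. A i)}} = (\<Union>i. {x. \<not> meager {g\<in>U. (x, g) \<in> A i}})"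
    by auto
  also have "\<dots> \<in> sets borel"
    using union by (intro sets.countable_UN) auto
  finally show ?case .
qed

section \<open>Borel selection for large sections\<close>

text \<open>Covers rather than partitions, so that closed balls of a fixed radius around a dense set
  qualify directly.\<close>

definition borel_cover :: "(nat \<Rightarrow> nat \<Rightarrow> 'a::topological_space set) \<Rightarrow> bool" where
  "borel_cover R \<longleftrightarrow> (\<forall>k i. R k i \<in> sets borel) \<and> (\<forall>k. (\<Union>i. R k i) = UNIV)"

text \<open>Both sides of \<open>W\<close> are treated alike, which makes the sets decided by some cover closed under
  complements.\<close>

definition decides :: "(nat \<Rightarrow> nat \<Rightarrow> 'a::topological_space set) \<Rightarrow> 'a set \<Rightarrow> bool" where
  "decides R W \<longleftrightarrow>
     (\<forall>b z l. (\<forall>k. \<forall>\<^sub>F n in sequentially. z n \<in> R k (b k)) \<longrightarrow> z \<longlonglongrightarrow> l \<longrightarrow>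
        (\<forall>\<^sub>F n in sequentially. z n \<in> W \<longleftrightarrow> l \<in> W))"

lemma decidesD:
  assumes "decides R W" "\<And>k. \<forall>\<^sub>F n in sequentially. z n \<in> R k (b k)" "z \<longlonglongrightarrow> l"
  shows "\<forall>\<^sub>F n in sequentially. z n \<in> W \<longleftrightarrow> l \<in> W"
  using assms unfolding decides_def by blast

lemma borel_cover_merge:
  assumes "\<And>j::nat. borel_cover (R j)"
  obtains R' where "borel_cover R'" "\<And>j k. \<exists>k'. R' k' = R j k"
proof
  let ?R = "\<lambda>k. R (fst (prod_decode k)) (snd (prod_decode k))"
  show "borel_cover ?R"
    using assms unfolding borel_cover_def by blast
  show "\<exists>k'. ?R k' = R j k" for j k
    by (intro exI[of _ "prod_encode (j, k)"]) simp
qed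

text \<open>Adding covers only shrinks the class of sequences that have to be tested.\<close>

lemma decides_mono:
  assumes "decides R W" "\<And>k. \<exists>k'. R' k' = R k"
  shows "decides R' W"
proof -
  obtain f where f: "\<And>k. R' (f k) = R k"
    using assms(2) by metis
  show ?thesis
    unfolding decides_def
  proof (intro allI impI)
    fix b and z :: "nat \<Rightarrow> 'a" and l
    assume "\<forall>k. \<forall>\<^sub>F n in sequentially. z n \<in> R' k (b k)" "z \<longlonglongrightarrow> l"
    then show "\<forall>\<^sub>F n in sequentially. z n \<in> W \<longleftrightarrow> l \<in> W"
      by (intro decidesD[OF assms(1), where b = "b \<circ> f"]) (auto simp flip: f)
  qed
qed

lemma open_eq_Union_closed:
  fixes W :: "'a::metric_space set"
  assumes "open W"
  obtains K :: "nat \<Rightarrow> 'a set" where "\<And>i. closed (K i)" "W = (\<Union>i. K i)"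
proof
  let ?K = "\<lambda>i. - (\<Union>y\<in>-W. ball y (inverse (real (Suc i))))"
  show "closed (?K i)" for i
    by (auto intro!: closed_Compl)
  show "W = (\<Union>i. ?K i)"
  proof safe
    fix x assume "x \<in> W"
    then obtain e where e: "e > 0" "ball x e \<subseteq> W"
      using assms open_contains_ball by blast
    then obtain i where "inverse (real (Suc i)) < e"
      using reals_Archimedean by blast
    with e have "x \<in> ?K i"
      by (force simp: dist_commute)
    then show "x \<in> (\<Union>i. ?K i)" by blast
  next
    fix x i assume "x \<notin> (\<Union>y\<in>-W. ball y (inverse (real (Suc i))))"
    then show "x \<in> W" by (force simp del: of_nat_Suc)
  qed
qed

text \<open>Every cell of cover \<open>k\<close> is closed, so the limit lies in the cell that
  eventually contains the sequence, and each cell is either contained in \<open>W\<close> or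
  disjoint from it.\<close>

lemma decides_open:
  fixes K :: "nat \<Rightarrow> 'a::topological_space set"
  assumes "open W" "W = (\<Union>j. K j)" "\<And>j. closed (K j)" "R k = case_nat (- W) K"
  shows "decides R W"
  unfolding decides_def
proof (intro allI impI)
  fix b and z :: "nat \<Rightarrow> 'a" and l
  assume "\<forall>k. \<forall>\<^sub>F n in sequentially. z n \<in> R k (b k)" and l: "z \<longlonglongrightarrow> l"
  then have z: "\<forall>\<^sub>F n in sequentially. z n \<in> case_nat (- W) K (b k)"
    using assms(4) by metis
  have "closed (case_nat (- W) K (b k))"
    using assms(1,3) by (cases "b k") (simp_all add: closed_Compl)
  then have "l \<in> case_nat (- W) K (b k)"
    using z l by (rule Lim_in_closed_set[OF _ _ sequentially_bot])
  with z show "\<forall>\<^sub>F n in sequentially. z n \<in> W \<longleftrightarrow> l \<in> W"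
    by (cases "b k") (auto simp: assms(2) elim!: eventually_mono)
qed

text \<open>The cells here need not be closed, but each \<open>K j\<close> is already decided:
  eventual membership in \<open>K j\<close> passes to the limit, and so does eventual avoidance of
  every \<open>K j\<close>.\<close>

lemma decides_UN:
  fixes K :: "nat \<Rightarrow> 'a::topological_space set"
  assumes "\<And>j. decides R (K j)" "R k = case_nat (- (\<Union>j. K j)) K"
  shows "decides R (\<Union>j. K j)"
  unfolding decides_def
proof (intro allI impI)
  fix b and z :: "nat \<Rightarrow> 'a" and l
  assume *: "\<forall>k. \<forall>\<^sub>F n in sequentially. z n \<in> R k (b k)" and l: "z \<longlonglongrightarrow> l"
  then have z: "\<forall>\<^sub>F n in sequentially. z n \<in> case_nat (- (\<Union>j. K j)) K (b k)"
    using assms(2) by metis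
  have K: "\<forall>\<^sub>F n in sequentially. z n \<in> K j \<longleftrightarrow> l \<in> K j" for j
    using assms(1) * l by (blast intro: decidesD)
  show "\<forall>\<^sub>F n in sequentially. z n \<in> (\<Union>j. K j) \<longleftrightarrow> l \<in> (\<Union>j. K j)"
  proof (cases "b k")
    case 0
    with z have z0: "\<forall>\<^sub>F n in sequentially. z n \<notin> (\<Union>j. K j)"
      by simp
    have "l \<notin> K j" for j
    proof
      assume "l \<in> K j"
      from K[of j] z0 have "\<forall>\<^sub>F n in sequentially. False"
        by (rule eventually_elim2) (use \<open>l \<in> K j\<close> in auto)
      then show False by simp
    qed
    with z0 show ?thesis by (auto elim!: eventually_mono)
  next
    case (Suc j)
    with z have zj: "\<forall>\<^sub>F n in sequentially. z n \<in> K j"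
      by simp
    with K[of j] have "\<forall>\<^sub>F n in sequentially. l \<in> K j"
      by (rule eventually_elim2) auto
    then have "l \<in> K j" by simp
    with zj show ?thesis by (auto elim!: eventually_mono)
  qed
qed

lemma borel_cover_split:
  assumes "\<And>j. K j \<in> sets borel"
  shows "borel_cover (\<lambda>k::nat. case_nat (- (\<Union>j. K j)) K)"
proof -
  have "- (\<Union>j. K j) \<in> sets borel"
    using assms by (intro borel_comp sets.countable_UN) auto
  moreover have "(\<Union>i. case_nat (- (\<Union>j. K j)) K i) = UNIV"
  proof -
    have "x \<in> case_nat (- (\<Union>j. K j)) K 0 \<or> (\<exists>j. x \<in> case_nat (- (\<Union>j. K j)) K (Suc j))" for x
      by auto
    then show ?thesis by blast
  qed
  ultimately show ?thesis
    using assms unfolding borel_cover_def by (auto split: nat.split)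
qed

text \<open>A substitute for refining a Polish topology until \<open>W\<close> becomes clopen: the
  original topology is kept, and only sequences that eventually settle into one cell of each cover
  are considered.\<close>

lemma borel_decided:
  fixes W :: "'a::metric_space set"
  assumes "W \<in> sets borel"
  shows "\<exists>R. borel_cover R \<and> decides R W"
  using assms
proof (induction rule: borel_induct)
  case (base W)
  obtain K :: "nat \<Rightarrow> 'a set" where K: "\<And>i. closed (K i)" "W = (\<Union>i. K i)"
    using open_eq_Union_closed[OF base] by metis
  then show ?case
    using base by (intro exI[of _ "\<lambda>k. case_nat (- W) K"])
      (auto intro!: decides_open[where K = K] borel_cover_split[of K] borel_closed)
next
  case (compl W)
  then show ?case by (simp add: decides_def)
next
  case (union A)
  then obtain R where R: "\<And>j. borel_cover (R j)" "\<And>j. decides (R j) (A j)"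
    by metis
  \<comment> \<open>Slot 0 carries the cover by the pieces and the complement of their union; slot
    \<open>Suc j\<close> carries the covers that decide \<open>A j\<close>.\<close>
  let ?R = "case_nat (\<lambda>k. case_nat (- (\<Union>j. A j)) A) R"
  have "borel_cover (?R j)" for j
    using R borel_cover_split[of A] union.hyps by (auto split: nat.split)
  then obtain R' where R': "borel_cover R'" "\<And>j k. \<exists>k'. R' k' = ?R j k"
    using borel_cover_merge[of ?R] by blast
  have "decides R' (A j)" for j
  proof (rule decides_mono[OF R(2)])
    show "\<exists>k'. R' k' = R j k" for k
      using R'(2)[of "Suc j" k] by simp
  qed
  moreover obtain k where "R' k = case_nat (- (\<Union>j. A j)) A"
    using R'(2)[of 0] by auto
  ultimately show ?case
    using R'(1) decides_UN by blast
qed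

section \<open>Leftmost branches\<close>

primrec greedy :: "(nat list \<Rightarrow> bool) \<Rightarrow> nat \<Rightarrow> nat list" where
  "greedy p 0 = []"
| "greedy p (Suc n) = greedy p n @ [LEAST i. p (greedy p n @ [i])]"

lemma length_greedy [simp]: "length (greedy p n) = n"
  by (induction n) auto

lemma nth_greedy: "k < n \<Longrightarrow> greedy p n ! k = greedy p (Suc k) ! k"
  by (induction n) (auto simp: nth_append less_Suc_eq)

lemma greedy_holds:
  assumes "p []" "\<And>s. p s \<Longrightarrow> \<exists>i. p (s @ [i])"
  shows "p (greedy p n)"
proof (induction n)
  case (Suc n)
  then show ?case
    using assms(2) by (auto intro: LeastI_ex)
qed (use assms in auto)

text \<open>There are only countably many lists, so measurability can be checked separately for each
  value of the previous prefix; taking the least next index is a measurable choice.\<close>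

lemma measurable_greedy [measurable]:
  assumes [measurable]: "\<And>s. Measurable.pred M (\<lambda>x. p x s)"
  shows "(\<lambda>x. greedy (p x) n) \<in> M \<rightarrow>\<^sub>M count_space UNIV"
proof (induction n)
  case (Suc n)
  note [measurable] = Suc
  show ?case
    unfolding greedy.simps
    by (rule measurable_compose_countable[where f = "\<lambda>s x. s @ [LEAST i. p x (s @ [i])]"]) measurable
qed simp

text \<open>Greedy choice of cells of the covers keeps the part of the fibre singled out so far large,
  so the points chosen at each stage have the same image under \<open>\<psi>\<close>; since the covers decide
  the preimages of basic open sets, the limit has that image too, as if \<open>\<psi>\<close> were continuous.\<close>

lemma borel_large_selection:
  fixes \<psi> :: "'x::polish_space \<Rightarrow> 'y::polish_space" and J :: "'x \<Rightarrow> 'x set \<Rightarrow> bool"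
  assumes \<psi>: "\<psi> \<in> borel_measurable borel"
    and J_UN: "\<And>x A. J x (\<Union>i::nat. A i) \<Longrightarrow> \<exists>i. J x (A i)"
    and J_fibre: "\<And>x A. J x A \<Longrightarrow> \<exists>z\<in>A. \<psi> z = \<psi> x"
    and J_borel: "\<And>A. A \<in> sets borel \<Longrightarrow> {x. J x A} \<in> sets borel"
    and J_cong: "\<And>x x'. \<psi> x = \<psi> x' \<Longrightarrow> J x = J x'"
  obtains C where "C \<in> sets borel" "inj_on \<psi> C" "C \<subseteq> {x. J x UNIV}"
    "\<And>x. J x UNIV \<Longrightarrow> \<exists>z\<in>C. \<psi> z = \<psi> x"
proof -
  obtain \<O> :: "nat \<Rightarrow> 'y set" where \<O>: "topological_basis (range \<O>)"
  proof -
    obtain \<B> :: "'y set set" where \<B>: "countable \<B>" "topological_basis \<B>"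
      using ex_countable_basis by blast
    then have "\<B> \<noteq> {}"
      using topological_basisE[of \<B> UNIV undefined] by auto
    with \<B> that[of "from_nat_into \<B>"] show ?thesis
      by (simp add: range_from_nat_into)
  qed
  have "\<exists>R. borel_cover R \<and> decides R (\<psi> -` \<O> m)" for m
  proof (rule borel_decided)
    have "\<O> m \<in> sets borel"
      using \<O> by (auto simp: topological_basis_open)
    then show "\<psi> -` \<O> m \<in> sets borel"
      using measurable_sets[OF \<psi>] by simp
  qed
  then obtain RO where RO: "\<And>m. borel_cover (RO m)" "\<And>m. decides (RO m) (\<psi> -` \<O> m)"
    by metis
  obtain d :: "nat \<Rightarrow> 'x" where d: "\<And>U. open U \<Longrightarrow> U \<noteq> {} \<Longrightarrow> \<exists>i. d i \<in> U"
  proof -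
    obtain Q :: "'x set" where Q: "countable Q" "\<And>U. open U \<Longrightarrow> U \<noteq> {} \<Longrightarrow> \<exists>q\<in>Q. q \<in> U"
      using countable_dense_exists by blast
    then have "Q \<noteq> {}" using Q(2)[of UNIV] by auto
    with Q that[of "from_nat_into Q"] show ?thesis
      by (metis from_nat_into_surj)
  qed
  \<comment> \<open>Closed balls of shrinking radius serve twice: they keep limits inside, and they
    force points that share a cell at every level to coincide.\<close>
  define RM where "RM n i = cball (d i) (inverse (real (Suc n)))" for n i
  have "borel_cover RM"
    unfolding borel_cover_def
  proof (intro conjI allI)
    show "RM k i \<in> sets borel" for k i
      unfolding RM_def by (intro borel_closed) simp
    have "x \<in> (\<Union>i. RM k i)" for x k
    proof -
      obtain i where "d i \<in> ball x (inverse (real (Suc k)))"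
        using d[of "ball x (inverse (real (Suc k)))"] by auto
      then show ?thesis
        unfolding RM_def by (auto simp: dist_commute intro!: exI[of _ i])
    qed
    then show "(\<Union>i. RM k i) = UNIV" for k by blast
  qed
  with RO(1) have "borel_cover (case_nat RM RO j)" for j
    by (auto split: nat.split)
  then obtain R where R: "borel_cover R" "\<And>j k. \<exists>k'. R k' = case_nat RM RO j k"
    using borel_cover_merge[of "case_nat RM RO"] by blast
  then have "\<exists>k'. R k' = RM k" for k
    by (metis nat.case(1))
  \<comment> \<open>The position in the merged sequence at which the \<open>n\<close>-th cover by
    balls reappears.\<close>
  then obtain \<kappa> where \<kappa>: "\<And>n. R (\<kappa> n) = RM n" by metis
  have R_dec: "decides R (\<psi> -` \<O> m)" for m
  proof (rule decides_mono[OF RO(2)])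
    show "\<exists>k'. R k' = RO m k" for k
      using R(2)[of "Suc m" k] by simp
  qed
  have R_borel: "R k i \<in> sets borel" and R_cover: "(\<Union>i. R k i) = UNIV" for k i
    using R(1) unfolding borel_cover_def by auto
  define P where "P s = (\<Inter>k<length s. R k (s ! k))" for s
  define p where "p x s = J x (P s)" for x s
  define b where "b x k = greedy (p x) (Suc k) ! k" for x k
  \<comment> \<open>The branch \<open>b x\<close> depends only on \<open>\<psi> x\<close>, so all
    points of \<open>C\<close> in one fibre lie in the same balls and at most one survives. Only the
    balls are tested, because the other cells need not be closed and could miss the limit
    \<open>l\<close> constructed below.\<close>
  define C where "C = {x. J x UNIV \<and> (\<forall>n. x \<in> RM n (b x (\<kappa> n)))}"
  have P_snoc: "P (s @ [i]) = P s \<inter> R (length s) i" for s i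
  proof -
    have "(\<Inter>k<length s. R k ((s @ [i]) ! k)) = P s"
      unfolding P_def by (intro INF_cong) (auto simp: nth_append)
    then show ?thesis
      unfolding P_def[of "s @ [i]"] by (simp add: lessThan_Suc Int_commute)
  qed
  have P_borel: "P s \<in> sets borel" for s
    unfolding P_def
  proof (cases "length s = 0")
    case False
    then show "(\<Inter>k<length s. R k (s ! k)) \<in> sets borel"
      by (intro sets.finite_INT) (auto intro: R_borel)
  qed auto
  have b_measurable: "(\<lambda>x. b x k) \<in> borel \<rightarrow>\<^sub>M count_space UNIV" for k
  proof -
    have "Measurable.pred borel (\<lambda>x. p x s)" for s
      using J_borel[OF P_borel] by (simp add: p_def pred_def)
    from measurable_greedy[where p = p, OF this]
    have "(\<lambda>x. greedy (p x) (Suc k)) \<in> borel \<rightarrow>\<^sub>M count_space UNIV" .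
    from measurable_compose[OF this, of "\<lambda>s. s ! k"] show ?thesis
      unfolding b_def by simp
  qed
  have b_cong: "b x = b x'" if "\<psi> x = \<psi> x'" for x x'
  proof -
    have "p x = p x'"
      using J_cong[OF that] by (simp add: p_def fun_eq_iff)
    then show ?thesis
      unfolding b_def by (simp only:)
  qed
  have P_greedy: "P (greedy (p x) n) = (\<Inter>k<n. R k (b x k))" for x n
    unfolding P_def b_def length_greedy
    by (intro INF_cong refl) (metis lessThan_iff nth_greedy)
  have RM_dist: "dist u v \<le> 2 * inverse (real (Suc n))" if "u \<in> RM n i" "v \<in> RM n i" for u v n i
    using that dist_triangle3[of u v "d i"] unfolding RM_def by auto
  show thesis
  proof (rule that[of C])
    have "C = {x. J x UNIV} \<inter> (\<Inter>n. \<Union>i. ((\<lambda>x. b x (\<kappa> n)) -` {i}) \<inter> RM n i)"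
      unfolding C_def by auto
    also have "\<dots> \<in> sets borel"
    proof -
      have "(\<lambda>x. b x (\<kappa> n)) -` {i} \<in> sets borel" for n i
        using measurable_sets[OF b_measurable, of "{i}"] by simp
      then have "(\<Union>i. ((\<lambda>x. b x (\<kappa> n)) -` {i}) \<inter> RM n i) \<in> sets borel" for n
        using \<open>borel_cover RM\<close> by (intro sets.countable_UN) (auto simp: borel_cover_def)
      then show ?thesis
        using J_borel[of UNIV] by (intro sets.Int sets.countable_INT) auto
    qed
    finally show "C \<in> sets borel" .
    show "C \<subseteq> {x. J x UNIV}"
      unfolding C_def by auto
    show "inj_on \<psi> C"
    proof (rule inj_onI)
      fix u v assume "u \<in> C" "v \<in> C" "\<psi> u = \<psi> v"
      then have "dist u v \<le> 2 * inverse (real (Suc n))" for n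
        using b_cong[of u v] by (intro RM_dist[of u n "b u (\<kappa> n)"]) (auto simp: C_def)
      moreover have "(\<lambda>n. 2 * inverse (real (Suc n))) \<longlonglongrightarrow> 2 * 0"
        by (intro tendsto_intros LIMSEQ_inverse_real_of_nat)
      ultimately have "dist u v \<le> 0"
        by (metis (no_types, lifting) LIMSEQ_le_const mult_zero_right)
      then show "u = v" by simp
    qed
    fix x assume x: "J x UNIV"
    have large: "p x (greedy (p x) n)" for n
    proof (rule greedy_holds)
      show "p x []" using x by (simp add: p_def P_def)
      fix s assume "p x s"
      moreover have "P s = (\<Union>i. P (s @ [i]))"
        using R_cover[of "length s"] by (auto simp: P_snoc)
      ultimately show "\<exists>i. p x (s @ [i])"
        unfolding p_def using J_UN[of x "\<lambda>i. P (s @ [i])"] by simp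
    qed
    have "\<exists>z. (\<forall>k<n. z \<in> R k (b x k)) \<and> \<psi> z = \<psi> x" for n
      using J_fibre large[of n] unfolding p_def P_greedy by blast
    then obtain z where z: "\<And>n k. k < n \<Longrightarrow> z n \<in> R k (b x k)" "\<And>n. \<psi> (z n) = \<psi> x"
      by metis
    have ev: "\<forall>\<^sub>F n in sequentially. z n \<in> R k (b x k)" for k
      using z(1) by (intro eventually_sequentiallyI[of "Suc k"]) auto
    have "Cauchy z"
    proof (rule metric_CauchyI)
      fix e :: real assume "0 < e"
      then obtain n where n: "inverse (real (Suc n)) < e / 2"
        using reals_Archimedean[of "e / 2"] by auto
      have "dist (z i) (z j) < e" if "i > \<kappa> n" "j > \<kappa> n" for i j
        using RM_dist[of "z i" n "b x (\<kappa> n)" "z j"] z(1)[OF that(1)] z(1)[OF that(2)] n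
        by (simp add: \<kappa> del: of_nat_Suc)
      then show "\<exists>M. \<forall>i\<ge>M. \<forall>j\<ge>M. dist (z i) (z j) < e"
        by (intro exI[of _ "Suc (\<kappa> n)"]) auto
    qed
    then obtain l where l: "z \<longlonglongrightarrow> l"
      using Cauchy_convergent convergent_def by blast
    have same_basic: "\<psi> x \<in> \<O> m \<longleftrightarrow> \<psi> l \<in> \<O> m" for m
      using decidesD[OF R_dec ev l, of m] by (simp add: z(2))
    have l_eq: "\<psi> l = \<psi> x"
    proof (rule ccontr)
      assume "\<psi> l \<noteq> \<psi> x"
      then obtain U where U: "open U" "\<psi> l \<in> U" "\<psi> x \<notin> U"
        using separation_t1 by blast
      obtain V where "V \<in> range \<O>" "\<psi> l \<in> V" "V \<subseteq> U"
        using topological_basisE[OF \<O> U(1,2)] .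
      with U(3) same_basic show False by blast
    qed
    have "l \<in> RM n (b x (\<kappa> n))" for n
    proof (rule Lim_in_closed_set[OF _ _ sequentially_bot l])
      show "closed (RM n (b x (\<kappa> n)))" by (simp add: RM_def)
      show "\<forall>\<^sub>F i in sequentially. z i \<in> RM n (b x (\<kappa> n))"
        using ev[of "\<kappa> n"] by (simp add: \<kappa>)
    qed
    then have "l \<in> C"
      using x J_cong[OF l_eq] b_cong[OF l_eq] by (simp add: C_def)
    with l_eq show "\<exists>z\<in>C. \<psi> z = \<psi> x" by blast
  qed
qed

section \<open>Polish group actions\<close>

theorem theorem1:
  fixes act :: "'g::{polish_space, group_add} \<Rightarrow> 'x::polish_space \<Rightarrow> 'x"
    and F :: "('y::polish_space \<times> 'y) set"
  assumes "polish_group TYPE('g)"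
    and "continuous_action act"
    and "countable_borel_eqrel F"
    and "borel_bireducible (orbit_eqrel act) F"
  shows "sigma_lacunary act"
proof -
  have act_cont: "continuous_on UNIV (\<lambda>p. act (fst p) (snd p))"
    and act_0: "act 0 x = x" and act_add: "act (g + h) x = act g (act h x)" for g h x
    using assms(2) unfolding continuous_action_def by auto
  have act_minus: "act (- g) (act g x) = x" "act g (act (- g) x) = x" for g x
    by (simp_all flip: act_add add: act_0)
  have plus_cont: "continuous_on UNIV (\<lambda>g::'g. g + h)" for h
  proof -
    have "continuous_on UNIV (\<lambda>p::'g \<times> 'g. fst p + snd p)"
      using assms(1) unfolding polish_group_def by blast
    from continuous_on_compose2[OF this, of UNIV "\<lambda>g. (g, h)"] show ?thesis
      by (simp add: continuous_on_Pair)
  qed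
  have meager_shift: "meager {g. g + h \<in> S} \<longleftrightarrow> meager S" for h :: 'g and S
  proof -
    have *: "meager {g. g + h \<in> S}" if "meager S" for h :: 'g and S
      using meager_vimage_homeomorphism[of "\<lambda>g. g + h" "\<lambda>g. g + (- h)", OF plus_cont plus_cont _ _ that]
      by (simp add: vimage_def add.assoc)
    show ?thesis
      using *[of S h] *[of "{g. g + h \<in> S}" "- h"] by (auto simp: add.assoc)
  qed
  have F: "equiv UNIV F" "\<And>y. countable (F `` {y})"
    using assms(3) unfolding countable_borel_eqrel_def by auto
  obtain \<psi> where \<psi> [measurable]: "\<psi> \<in> borel_measurable borel"
    and \<psi>_iff: "\<And>x y. (\<exists>g. act g x = y) \<longleftrightarrow> (\<psi> x, \<psi> y) \<in> F"
    using assms(4) unfolding borel_bireducible_def borel_reducible_def orbit_eqrel_def by auto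
  have \<psi>_eq_orbit: "\<exists>g. act g x = y" if "\<psi> x = \<psi> y" for x y
    using \<psi>_iff that F(1) by (metis UNIV_I equiv_def refl_onD)

  \<comment> \<open>Largeness along orbits\<close>
  have [measurable]: "(\<lambda>p::'x \<times> 'g. act (snd p) (fst p)) \<in> borel_measurable borel"
    using continuous_on_compose2[OF act_cont, of UNIV "\<lambda>p::'x \<times> 'g. (snd p, fst p)"]
    by (intro borel_measurable_continuous_onI)
      (simp add: continuous_on_Pair continuous_on_fst continuous_on_snd)
  have [measurable]: "(fst :: 'x \<times> 'g \<Rightarrow> 'x) \<in> borel_measurable borel"
    by (intro borel_measurable_continuous_onI continuous_intros)
  have \<psi>_act [measurable]: "(\<lambda>p::'x \<times> 'g. \<psi> (act (snd p) (fst p))) \<in> borel_measurable borel"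
    and \<psi>_fst [measurable]: "(\<lambda>p::'x \<times> 'g. \<psi> (fst p)) \<in> borel_measurable borel"
    by (intro measurable_compose[OF _ \<psi>]; measurable)+
  have fibre_borel: "{p::'x \<times> 'g. \<psi> (act (snd p) (fst p)) = \<psi> (fst p)} \<in> sets borel"
  proof -
    have "closed {p::'y \<times> 'y. fst p = snd p}"
      by (intro closed_Collect_eq continuous_intros)
    from measurable_sets[OF borel_measurable_Pair[OF \<psi>_act \<psi>_fst] borel_closed[OF this]]
    show ?thesis by (simp add: vimage_def)
  qed
  \<comment> \<open>The sets that fail \<open>J x\<close> form a sigma-ideal: the meager ideal
    carried over by the orbit map of \<open>x\<close>, restricted to the group elements that keep
    \<open>x\<close> in its fibre.\<close>
  define J where "J x A \<longleftrightarrow> \<not> meager {g. \<psi> (act g x) = \<psi> x \<and> act g x \<in> A}" for x A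

  obtain C where C: "C \<in> sets borel" "inj_on \<psi> C" "C \<subseteq> {x. J x UNIV}"
    "\<And>x. J x UNIV \<Longrightarrow> \<exists>z\<in>C. \<psi> z = \<psi> x"
  proof (rule borel_large_selection[of \<psi> J])
    show "\<exists>i. J x (A i)" if "J x (\<Union>i::nat. A i)" for x A
    proof -
      have "{g. \<psi> (act g x) = \<psi> x \<and> act g x \<in> (\<Union>i. A i)}
          = (\<Union>i. {g. \<psi> (act g x) = \<psi> x \<and> act g x \<in> A i})"
        by auto
      then show ?thesis
        using that meager_Union[of UNIV "\<lambda>i. {g. \<psi> (act g x) = \<psi> x \<and> act g x \<in> A i}"]
        unfolding J_def by auto
    qed
    show "\<exists>z\<in>A. \<psi> z = \<psi> x" if "J x A" for x A
    proof (rule ccontr)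
      assume "\<not> ?thesis"
      then have "{g. \<psi> (act g x) = \<psi> x \<and> act g x \<in> A} = {}" by auto
      with that show False unfolding J_def by (metis meager_empty)
    qed
    show "{x. J x A} \<in> sets borel" if "A \<in> sets borel" for A
    proof -
      have "(\<lambda>p::'x \<times> 'g. act (snd p) (fst p)) -` A \<in> sets borel"
        using measurable_sets[of "\<lambda>p::'x \<times> 'g. act (snd p) (fst p)" borel borel A] that by simp
      with fibre_borel have "{p::'x \<times> 'g. \<psi> (act (snd p) (fst p)) = \<psi> (fst p)} \<inter>
          (\<lambda>p. act (snd p) (fst p)) -` A \<in> sets borel"
        by (rule sets.Int)
      from Montgomery_Novikov[OF this open_UNIV] show ?thesis
        by (simp add: J_def)
    qed
    show "J x = J x'" if "\<psi> x = \<psi> x'" for x x'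
    proof
      fix A
      obtain h where h: "act h x = x'"
        using \<psi>_eq_orbit \<open>\<psi> x = \<psi> x'\<close> by blast
      \<comment> \<open>The orbit maps of \<open>x\<close> and \<open>x'\<close> differ by the right
        translation by \<open>h\<close>, which preserves meagerness.\<close>
      have "{g. \<psi> (act g x') = \<psi> x' \<and> act g x' \<in> A}
          = {g. g + h \<in> {g. \<psi> (act g x) = \<psi> x \<and> act g x \<in> A}}"
        using that by (auto simp: act_add h)
      then show "J x A = J x' A"
        unfolding J_def by (simp only: meager_shift)
    qed
  qed (use \<psi> in auto)

  have C_complete: "\<exists>z\<in>C. \<exists>g. act g x = z" for x
  proof -
    \<comment> \<open>On the orbit \<open>\<psi>\<close> takes only countably many values, so by
      Baire category one value \<open>y\<close> is attained for nonmeagerly many group elements.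
      Passing to a point \<open>act h x\<close> with this value makes its own fibre large.\<close>
    have "(UNIV :: 'g set) = (\<Union>y\<in>F `` {\<psi> x}. {g. \<psi> (act g x) = y})"
      using \<psi>_iff by auto
    then obtain y where "\<not> meager {g. \<psi> (act g x) = y}"
      using meager_Union[OF F(2), of "\<psi> x" "\<lambda>y. {g. \<psi> (act g x) = y}"] not_meager_open[of "UNIV :: 'g set"]
      by auto
    moreover from this obtain h where h: "\<psi> (act h x) = y"
      by (metis (mono_tags, lifting) empty_Collect_eq meager_empty)
    moreover have "{g. \<psi> (act g (act h x)) = y} = {g. g + h \<in> {g. \<psi> (act g x) = y}}"
      by (auto simp: act_add)
    ultimately have "J (act h x) UNIV"
      unfolding J_def by (simp only: meager_shift UNIV_I simp_thms)
    then obtain z where z: "z \<in> C" "\<psi> z = \<psi> (act h x)"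
      using C(4) by blast
    then obtain g where "act g (act h x) = z"
      using \<psi>_eq_orbit[of "act h x" z] by auto
    with z show ?thesis
      by (metis act_add)
  qed

  \<comment> \<open>Lacunary pieces\<close>
  obtain W :: "nat \<Rightarrow> 'g set" where W: "\<And>n. open (W n)" "\<And>n. W n \<noteq> {}"
    "\<And>U. open U \<Longrightarrow> U \<noteq> {} \<Longrightarrow> \<exists>n. W n \<subseteq> U"
  proof -
    obtain \<B> :: "'g set set" where \<B>: "countable \<B>" "topological_basis \<B>"
      using ex_countable_basis by blast
    define \<B>' where "\<B>' = \<B> - {{}}"
    have *: "\<exists>V\<in>\<B>'. V \<subseteq> U" if "open U" "U \<noteq> {}" for U
      using that \<B>(2) unfolding \<B>'_def by (metis Diff_iff ex_in_conv singletonD topological_basisE)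
    have "\<B>' \<noteq> {}" using *[of UNIV] by auto
    moreover have "countable \<B>'" using \<B>(1) by (simp add: \<B>'_def)
    ultimately have range: "range (from_nat_into \<B>') = \<B>'"
      by (rule range_from_nat_into)
    show ?thesis
    proof (rule that[of "from_nat_into \<B>'"])
      have "from_nat_into \<B>' n \<in> \<B>'" for n
        using range by blast
      then show "open (from_nat_into \<B>' n)" "from_nat_into \<B>' n \<noteq> {}" for n
        using topological_basis_open[OF \<B>(2)] unfolding \<B>'_def by auto
      show "\<exists>n. from_nat_into \<B>' n \<subseteq> U" if "open U" "U \<noteq> {}" for U
        using *[OF that] range by (metis rangeE)
    qed
  qed
  have "\<forall>n. \<exists>g. g \<in> W n"
    using W(2) by blast
  then obtain q where q: "\<And>n. q n \<in> W n"
    by metis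
  define C' where "C' n = {z\<in>C. meager {g\<in>W n. \<psi> (act g z) \<noteq> \<psi> z}}" for n
  \<comment> \<open>Translating by \<open>q n\<close> turns \<open>W n\<close> into the
    neighbourhood \<open>V n\<close> of the identity. An element \<open>h\<close> acting between
    points of \<open>B n\<close> becomes the conjugate \<open>- q n + h + q n\<close> acting between
    points of \<open>C' n\<close>.\<close>
  define B where "B n = {x. act (- q n) x \<in> C' n}" for n
  define V where "V n = {g. g + q n \<in> W n}" for n
  have C'_subset: "C' n \<subseteq> C" for n
    by (auto simp: C'_def)
  have C'_borel: "C' n \<in> sets borel" for n
  proof -
    have "- {p::'x \<times> 'g. \<psi> (act (snd p) (fst p)) = \<psi> (fst p)} \<in> sets borel"
      by (intro borel_comp fibre_borel)
    from Montgomery_Novikov[OF this W(1)[of n]]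
    have "C - {x. \<not> meager {g\<in>W n. \<psi> (act g x) \<noteq> \<psi> x}} \<in> sets borel"
      using C(1) by (intro sets.Diff) simp_all
    also have "C - {x. \<not> meager {g\<in>W n. \<psi> (act g x) \<noteq> \<psi> x}} = C' n"
      by (auto simp: C'_def)
    finally show ?thesis .
  qed

  show ?thesis
    unfolding sigma_lacunary_def
  proof (intro exI conjI allI)
    show "B n \<in> sets borel" for n
    proof -
      have "act (- q n) \<in> borel_measurable borel"
        using continuous_on_compose2[OF act_cont, of UNIV "\<lambda>x. (- q n, x)"]
        by (intro borel_measurable_continuous_onI) (simp add: continuous_on_Pair)
      from measurable_sets[OF this C'_borel] show ?thesis
        by (simp add: B_def vimage_def)
    qed
    show "open (V n)" for n
      using open_vimage[OF W(1) plus_cont] by (simp add: V_def vimage_def)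
    show "0 \<in> V n" for n
      using q by (simp add: V_def)
    show "lacunary act (V n) (B n)" for n
      unfolding lacunary_def
    proof (intro ballI impI)
      fix h x x' assume h: "h \<in> V n" and "x \<in> B n" "x' \<in> B n" and x': "act h x = x'"
      define z z' k where "z = act (- q n) x" and "z' = act (- q n) x'" and "k = - q n + h + q n"
      have z: "z \<in> C' n" "z' \<in> C' n"
        using \<open>x \<in> B n\<close> \<open>x' \<in> B n\<close> by (auto simp: B_def z_def z'_def)
      have k: "act k z = z'"
        by (simp add: k_def z_def z'_def act_add act_minus x')
      \<comment> \<open>This turns the comeager condition at \<open>z'\<close> into one about the
        orbit map of \<open>z\<close>, at the cost of translating \<open>W n\<close> by
        \<open>k\<close>.\<close>
      have "act (g + (- k)) z' = act g z" for g
        by (simp only: act_add act_minus flip: k)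
      moreover have "meager {g\<in>W n. \<psi> (act g z') \<noteq> \<psi> z'}"
        using z by (simp add: C'_def)
      ultimately have "meager {g. g + (- k) \<in> W n \<and> \<psi> (act g z) \<noteq> \<psi> z'}"
        using meager_shift[of "- k" "{g\<in>W n. \<psi> (act g z') \<noteq> \<psi> z'}"]
        by (simp only: mem_Collect_eq)
      then have "meager ({g\<in>W n. \<psi> (act g z) \<noteq> \<psi> z} \<union>
          {g. g + (- k) \<in> W n \<and> \<psi> (act g z) \<noteq> \<psi> z'})"
        using z by (intro meager_Un) (auto simp: C'_def)
      moreover have "\<not> meager (W n \<inter> (\<lambda>g. g + (- k)) -` W n)"
      proof (rule not_meager_open)
        show "open (W n \<inter> (\<lambda>g. g + (- k)) -` W n)"
          by (intro open_Int W(1) open_vimage plus_cont)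
        \<comment> \<open>The overlap of \<open>W n\<close> with its translate contains
          \<open>h + q n\<close>, since \<open>q n + k = h + q n\<close>.\<close>
        have "h + q n \<in> W n"
          using h by (simp add: V_def)
        moreover have "h + q n + (- k) = q n"
          by (simp only: k_def minus_add add.assoc minus_minus add_minus_cancel right_minus add_0_right)
        ultimately have "h + q n \<in> W n \<inter> (\<lambda>g. g + (- k)) -` W n"
          using q by simp
        then show "W n \<inter> (\<lambda>g. g + (- k)) -` W n \<noteq> {}" by blast
      qed
      \<comment> \<open>The nonmeager overlap is not covered by the two exceptional sets, so some
        \<open>g\<close> is good for both \<open>z\<close> and \<open>z'\<close>.\<close>
      ultimately have "\<not> W n \<inter> (\<lambda>g. g + (- k)) -` W n \<subseteq> {g\<in>W n. \<psi> (act g z) \<noteq> \<psi> z} \<union>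
          {g. g + (- k) \<in> W n \<and> \<psi> (act g z) \<noteq> \<psi> z'}"
        using meager_subset by blast
      then obtain g where "\<psi> (act g z) = \<psi> z" "\<psi> (act g z) = \<psi> z'"
        by auto
      then have "\<psi> z = \<psi> z'" by simp
      then have "z = z'"
        using z C'_subset C(2) by (meson inj_on_def subsetD)
      then show "x = x'"
        unfolding z_def z'_def by (metis act_minus(2))
    qed
    show "countable_complete_section (orbit_eqrel act) (\<Union>n. B n)"
      unfolding countable_complete_section_def
    proof (intro conjI allI)
      fix x
      obtain z g where z: "z \<in> C" "act g x = z"
        using C_complete by blast
      \<comment> \<open>Points of \<open>C\<close> have large fibres. The Baire property upgrades
        nonmeager to comeager in some open \<open>U\<close>, and any \<open>W n\<close> inside
        \<open>U\<close> puts \<open>z\<close> into \<open>C' n\<close>.\<close>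
      have "\<not> meager (UNIV \<inter> {g. \<psi> (act g z) = \<psi> z})"
        using z C(3) by (auto simp: J_def)
      moreover have "baire_property {g. \<psi> (act g z) = \<psi> z}"
        using borel_section[OF fibre_borel, of z] by (intro baire_property_borel) simp
      ultimately obtain U where U: "open U" "U \<noteq> {}" "meager (U - {g. \<psi> (act g z) = \<psi> z})"
        unfolding baire_property_def by blast
      then obtain n where "W n \<subseteq> U" using W(3) by blast
      then have "meager {g\<in>W n. \<psi> (act g z) \<noteq> \<psi> z}"
        using U(3) by (auto intro: meager_subset)
      then have "act (q n) z \<in> B n"
        using z by (simp add: B_def C'_def act_minus)
      moreover have "(x, act (q n) z) \<in> orbit_eqrel act"
        using z by (auto simp: orbit_eqrel_def simp flip: act_add)
      ultimately show "\<exists>y\<in>\<Union>n. B n. (x, y) \<in> orbit_eqrel act" by blast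
    next
      fix x
      \<comment> \<open>On \<open>Z\<close> the map \<open>\<psi>\<close> is injective with values
        in one \<open>F\<close>-class, which makes \<open>Z\<close> countable; each point of
        \<open>B n\<close> in the orbit is the \<open>q n\<close> translate of a point of
        \<open>Z\<close>.\<close>
      define Z where "Z = {z\<in>C. (\<psi> x, \<psi> z) \<in> F}"
      have "countable (\<psi> ` Z)"
        by (rule countable_subset[OF _ F(2)[of "\<psi> x"]]) (auto simp: Z_def)
      moreover have "inj_on \<psi> Z"
        using C(2) by (rule inj_on_subset) (auto simp: Z_def)
      ultimately have "countable Z"
        by (rule countable_image_inj_on)
      moreover have "(\<Union>n. B n) \<inter> orbit_eqrel act `` {x} \<subseteq> (\<Union>n. act (q n) ` Z)"
      proof
        fix y assume "y \<in> (\<Union>n. B n) \<inter> orbit_eqrel act `` {x}"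
        then obtain n g where y: "act (- q n) y \<in> C" "y = act g x"
          using C'_subset by (auto simp: B_def orbit_eqrel_def)
        then have "(\<psi> x, \<psi> (act (- q n) y)) \<in> F"
          using \<psi>_iff by (metis act_add)
        with y(1) have "act (q n) (act (- q n) y) \<in> act (q n) ` Z"
          by (intro imageI) (simp add: Z_def)
        then show "y \<in> (\<Union>n. act (q n) ` Z)"
          using act_minus(2)[of "q n" y] by auto
      qed
      ultimately show "countable ((\<Union>n. B n) \<inter> orbit_eqrel act `` {x})"
        by (meson countable_UN countableI_type countable_image countable_subset)
    qed
  qed
qed

end
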